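(* Let $\mu\in M_{\text{loc}}$. Then the derivation $\overline{D}_{\mu}$ on $M_{\text{loc}}$, given by $\overline{D}_\mu\nu=X\nu*\mu$ $(\nu\in M_{\text{loc}})$, is weak-star continuous on $M_{\text{loc}}$.
   Context: All spaces are complex and $\mathbb R^+=[0,\infty)$. $M_{\text{loc}}$ is the space of complex Radon measures on $\mathbb R^+$, that is, locally finite complex Borel measures on $\mathbb R^+$ ($|\mu|([0,n))<\infty$ for every $n\in\mathbb N$). With the seminorms $\mu\mapsto|\mu|([0,n))$, $n\in\mathbb N$, and convolution, determined by $\int_{\mathbb R^+} h\,d(\nu*\mu)=\int_{\mathbb R^+}\int_{\mathbb R^+}h(t+s)\,d\mu(s)\,d\nu(t)$ for compactly supported continuous $h$ on $\mathbb R^+$, it is a Fréchet algebra. $X$ is given by $d(X\nu)(t)=t\,d\nu(t)$. It is known that $\overline D_\mu$ is a continuous derivation on $M_{\text{loc}}$. $C_c$ is the space of compactly supported continuous functions on $\mathbb R^+$, with its topology as the inductive limit of the spaces $C_0[0,n)$ (continuous functions $h$ on $[0,n]$ with $h(n)=0$, supremum norm, extended by $0$). $M_{\text{loc}}$ is identified with the dual of $C_c$ via $\langle h,\mu\rangle=\int_{\mathbb R^+}h\,d\mu$, and "weak-star" refers to this duality, i.e. to the topology $\sigma(M_{\text{loc}},C_c)$. *)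

theory Defs
  imports "HOL-Analysis.Analysis"
begin

text \<open>
  The half line is the set \<open>{0..}\<close> of real numbers. A locally finite complex Borel measure need
  not have a value on unbounded Borel sets (its total variation may be infinite), so it is
  represented as a complex set function on the bounded Borel subsets of the half line. Outside
  that domain it takes the value 0, which makes equality of measures equality of functions.
\<close>

definition bounded_borel :: "real set set" where
  "bounded_borel = {A \<in> sets borel. A \<subseteq> {0..} \<and> bounded A}"

definition total_variation :: "(real set \<Rightarrow> complex) \<Rightarrow> real set \<Rightarrow> ennreal" where
  "total_variation m A =
     (SUP P \<in> {P. finite P \<and> disjoint P \<and> P \<subseteq> bounded_borel \<and> \<Union>P \<subseteq> A}.
        \<Sum>B\<in>P. ennreal (cmod (m B)))"

definition M_loc :: "(real set \<Rightarrow> complex) set" where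
  "M_loc = {m.
     (\<forall>A. A \<notin> bounded_borel \<longrightarrow> m A = 0) \<and>
     (\<forall>A :: nat \<Rightarrow> real set. range A \<subseteq> bounded_borel \<longrightarrow> disjoint_family A \<longrightarrow>
        (\<Union>i. A i) \<in> bounded_borel \<longrightarrow> (\<lambda>i. m (A i)) sums m (\<Union>i. A i)) \<and>
     (\<forall>n :: nat. total_variation m {0..<real n} < \<infinity>)}"

text \<open>
  The positive part \<open>r\<^sup>+(A) = sup {r(B) | B \<subseteq> A}\<close> of the Jordan decomposition \<open>r = r\<^sup>+ - (- r)\<^sup>+\<close> of
  a real set function, as a positive Borel measure on the half line. Negative values of \<open>r\<close> do not
  matter in the supremum: \<^const>\<open>ennreal\<close> sends them to 0, which is also the value at \<open>B = {}\<close>.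
\<close>

definition jordan_pos :: "(real set \<Rightarrow> real) \<Rightarrow> real measure" where
  "jordan_pos r = measure_of {0..} (sets (restrict_space borel {0..}))
     (\<lambda>A. SUP B \<in> {B \<in> bounded_borel. B \<subseteq> A}. ennreal (r B))"

definition integral_loc :: "(real set \<Rightarrow> complex) \<Rightarrow> (real \<Rightarrow> complex) \<Rightarrow> complex" where
  "integral_loc m f =
     ((\<integral>t. f t \<partial>jordan_pos (\<lambda>A. Re (m A))) - (\<integral>t. f t \<partial>jordan_pos (\<lambda>A. - Re (m A)))) +
     \<i> * ((\<integral>t. f t \<partial>jordan_pos (\<lambda>A. Im (m A))) - (\<integral>t. f t \<partial>jordan_pos (\<lambda>A. - Im (m A))))"

text \<open>
  A function on the half line is given by a function on the reals whose values at negative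
  arguments are irrelevant: nothing below depends on them.
\<close>

definition C_c :: "(real \<Rightarrow> complex) set" where
  "C_c = {h. continuous_on {0..} h \<and> compact (closure {t \<in> {0..}. h t \<noteq> 0})}"

definition pairing :: "(real \<Rightarrow> complex) \<Rightarrow> (real set \<Rightarrow> complex) \<Rightarrow> complex" where
  "pairing h m = integral_loc m h"

text \<open>The coarsest topology on \<open>M_loc\<close> for which all functionals \<open>pairing h\<close>, \<open>h \<in> C_c\<close>, are
  continuous.\<close>

definition weak_star :: "(real set \<Rightarrow> complex) topology" where
  "weak_star = topology_generated_by {{m \<in> M_loc. pairing h m \<in> U} | h U. h \<in> C_c \<and> open U}"

lemma topspace_weak_star: "topspace weak_star = M_loc"
proof -
  have "(\<lambda>_. 0) \<in> C_c"
    by (simp add: C_c_def)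
  then have "M_loc \<in> {{m \<in> M_loc. pairing h m \<in> U} | h U. h \<in> C_c \<and> open U}"
    by (auto intro!: exI[of _ "\<lambda>_. 0"] exI[of _ UNIV])
  then show ?thesis
    unfolding weak_star_def topology_generated_by_topspace by blast
qed

text \<open>\<open>M_loc\<close> is the dual of \<open>C_c\<close>, so the formula below determines an element of \<open>M_loc\<close> for all
  \<open>\<nu>, \<mu> \<in> M_loc\<close>.\<close>

definition convolution ::
    "(real set \<Rightarrow> complex) \<Rightarrow> (real set \<Rightarrow> complex) \<Rightarrow> (real set \<Rightarrow> complex)" where
  "convolution \<nu> \<mu> = (THE \<kappa>. \<kappa> \<in> M_loc \<and>
     (\<forall>h\<in>C_c. integral_loc \<kappa> h = integral_loc \<nu> (\<lambda>t. integral_loc \<mu> (\<lambda>s. h (t + s)))))"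

definition X_op :: "(real set \<Rightarrow> complex) \<Rightarrow> (real set \<Rightarrow> complex)" where
  "X_op \<nu> = (\<lambda>A. if A \<in> bounded_borel
     then integral_loc \<nu> (\<lambda>t. indicator A t * complex_of_real t) else 0)"

definition D_bar :: "(real set \<Rightarrow> complex) \<Rightarrow> (real set \<Rightarrow> complex) \<Rightarrow> (real set \<Rightarrow> complex)" where
  "D_bar \<mu> \<nu> = convolution (X_op \<nu>) \<mu>"

end

theory Submission
  imports Defs
begin

text \<open>
  By the definition of convolution, \<open>\<langle>h, X\<nu> * \<mu>\<rangle> = \<integral> t g(t) d\<nu>(t)\<close> with \<open>g(t) = \<integral> h(t + s) d\<mu>(s)\<close>, and \<open>g\<close> is
  again a test function: it is continuous by dominated convergence and vanishes where \<open>h\<close> does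
  far out. Hence \<open>\<langle>h, X\<nu> * \<mu>\<rangle> = \<langle>X g, \<nu>\<rangle>\<close> is weak-star continuous in \<open>\<nu>\<close>. For this the convolution must
  exist and be unique. Existence comes from writing every element of \<open>M_loc\<close> as
  \<open>N\<^sub>0 + \<i> N\<^sub>1 - N\<^sub>2 - \<i> N\<^sub>3\<close> with locally finite positive measures and convolving these as images of
  product measures under addition; uniqueness from approximating indicators of intervals \<open>[0, a]\<close>
  by test functions.
\<close>

subsection \<open>Countably additive functions on bounded Borel sets\<close>

abbreviation half_borel :: "real measure" where
  "half_borel \<equiv> restrict_space borel {0..}"

lemma sets_half_borel_iff: "A \<in> sets half_borel \<longleftrightarrow> A \<in> sets borel \<and> A \<subseteq> {0..}"
  by (auto simp: sets_restrict_space_iff)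

lemma bounded_borel_half_borel: "A \<in> bounded_borel \<Longrightarrow> A \<in> sets half_borel"
  by (auto simp: bounded_borel_def sets_half_borel_iff)

lemma bounded_borel_sub: "A \<in> bounded_borel \<Longrightarrow> B \<in> sets borel \<Longrightarrow> B \<subseteq> A \<Longrightarrow> B \<in> bounded_borel"
  by (auto simp: bounded_borel_def intro: bounded_subset)

lemma bounded_borel_Un: "A \<in> bounded_borel \<Longrightarrow> B \<in> bounded_borel \<Longrightarrow> A \<union> B \<in> bounded_borel"
  by (auto simp: bounded_borel_def)

lemma bounded_borel_Diff: "A \<in> bounded_borel \<Longrightarrow> B \<in> bounded_borel \<Longrightarrow> A - B \<in> bounded_borel"
  by (auto simp: bounded_borel_def intro: bounded_subset)

lemma bounded_borel_Int: "A \<in> bounded_borel \<Longrightarrow> B \<in> sets borel \<Longrightarrow> A \<inter> B \<in> bounded_borel"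
  by (auto simp: bounded_borel_def intro: bounded_subset)

lemma bounded_borel_sets_borel: "A \<in> bounded_borel \<Longrightarrow> A \<in> sets borel"
  by (simp add: bounded_borel_def)

lemma bounded_borel_empty [simp]: "{} \<in> bounded_borel"
  by (simp add: bounded_borel_def)

lemma bounded_borel_Icc: "{0..a} \<in> bounded_borel"
  by (auto simp: bounded_borel_def)

lemma bounded_borel_bound: "A \<in> bounded_borel \<Longrightarrow> \<exists>n::nat. A \<subseteq> {0..<real n}"
proof -
  assume A: "A \<in> bounded_borel"
  then obtain K where K: "\<And>x. x \<in> A \<Longrightarrow> \<bar>x\<bar> \<le> K"
    by (auto simp: bounded_borel_def bounded_iff)
  obtain n :: nat where "K < real n"
    using reals_Archimedean2 by blast
  with K have "A \<subseteq> {..<real n}"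
    by force
  with A show ?thesis
    by (auto simp: bounded_borel_def intro!: exI[of _ n])
qed

text \<open>The value type is left open so that the same lemmas serve a complex set function and the
  real set functions from which its Jordan parts are built.\<close>

definition loc_additive :: "(real set \<Rightarrow> 'a::real_normed_vector) \<Rightarrow> bool" where
  "loc_additive m \<longleftrightarrow> (\<forall>A :: nat \<Rightarrow> real set. range A \<subseteq> bounded_borel \<longrightarrow> disjoint_family A \<longrightarrow>
     (\<Union>i. A i) \<in> bounded_borel \<longrightarrow> (\<lambda>i. m (A i)) sums m (\<Union>i. A i))"

lemma loc_additiveD:
  "loc_additive m \<Longrightarrow> range A \<subseteq> bounded_borel \<Longrightarrow> disjoint_family A \<Longrightarrow> (\<Union>i. A i) \<in> bounded_borel
    \<Longrightarrow> (\<lambda>i. m (A i)) sums m (\<Union>i. A i)"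
  by (auto simp: loc_additive_def)

text \<open>The constant family of empty sets is disjoint, so a constant series with term
  \<open>m {}\<close> converges, which forces the term to be 0.\<close>

lemma loc_additive_empty: "loc_additive m \<Longrightarrow> m {} = 0"
  using loc_additiveD[of m "\<lambda>_. {}"]
  by (auto simp: disjoint_family_on_def dest!: sums_summable simp: summable_const_iff)

lemma loc_additive_Un:
  assumes m: "loc_additive m" and A: "A \<in> bounded_borel" "B \<in> bounded_borel" "A \<inter> B = {}"
  shows "m (A \<union> B) = m A + m B"
proof -
  have 1: "(\<lambda>i. m (binaryset A B i)) sums m (\<Union>i. binaryset A B i)"
    using A by (intro loc_additiveD[OF m])
      (auto simp: range_binaryset_eq UN_binaryset_eq bounded_borel_Un disjoint_family_on_def binaryset_def)
  have "(\<lambda>i. m (binaryset A B i)) sums (m A + m B)"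
    by (intro binaryset_sums loc_additive_empty m)
  with 1 show ?thesis
    by (simp add: sums_unique2 UN_binaryset_eq)
qed

lemma loc_additive_Diff:
  assumes m: "loc_additive m" and A: "A \<in> bounded_borel" "B \<in> bounded_borel" "B \<subseteq> A"
  shows "m (A - B) = m A - m B"
proof -
  have "m ((A - B) \<union> B) = m (A - B) + m B"
    using A by (intro loc_additive_Un[OF m] bounded_borel_Diff) auto
  with A show ?thesis
    by (simp add: Un_absorb2)
qed

lemma M_loc_additive: "m \<in> M_loc \<Longrightarrow> loc_additive m"
  unfolding M_loc_def loc_additive_def by blast

text \<open>A single set \<open>B\<close> is already a competitor in the supremum defining the total
  variation. The resulting uniform bound is what makes the Jordan parts locally finite.\<close>

lemma M_loc_bounded:
  assumes "m \<in> M_loc"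
  obtains C where "\<And>B. B \<in> bounded_borel \<Longrightarrow> B \<subseteq> {0..<real n} \<Longrightarrow> cmod (m B) \<le> C"
proof -
  have fin: "total_variation m {0..<real n} < \<infinity>"
    using assms by (auto simp: M_loc_def)
  have "ennreal (cmod (m B)) \<le> total_variation m {0..<real n}"
    if "B \<in> bounded_borel" "B \<subseteq> {0..<real n}" for B
    unfolding total_variation_def using that
    by (intro SUP_upper2[of "{B}"]) auto
  then have "cmod (m B) \<le> enn2real (total_variation m {0..<real n})"
    if "B \<in> bounded_borel" "B \<subseteq> {0..<real n}" for B
    using that fin by (metis enn2real_ennreal enn2real_mono ennreal_le_iff infinity_ennreal_def norm_ge_zero)
  then show thesis
    using that by blast
qed

subsection \<open>The Jordan decomposition\<close>

text \<open>These are the positive building blocks of \<open>M_loc\<close>. Being genuine measures,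
  they may take the value \<infinity> on unbounded sets, where elements of \<open>M_loc\<close>
  carry only the default value 0.\<close>

definition loc_finite :: "real measure \<Rightarrow> bool" where
  "loc_finite N \<longleftrightarrow> sets N = sets half_borel \<and> (\<forall>n::nat. emeasure N {0..<real n} < \<infinity>)"

lemma loc_finite_sets: "loc_finite N \<Longrightarrow> sets N = sets half_borel"
  by (simp add: loc_finite_def)

lemma loc_finite_space: "loc_finite N \<Longrightarrow> space N = {0..}"
  by (drule loc_finite_sets, drule sets_eq_imp_space_eq) (simp add: space_restrict_space)

lemma loc_finite_bounded_borel:
  assumes "loc_finite N" "A \<in> bounded_borel"
  shows "emeasure N A < \<infinity>"
proof -
  obtain n :: nat where n: "A \<subseteq> {0..<real n}"
    using bounded_borel_bound[OF assms(2)] by blast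
  have "emeasure N A \<le> emeasure N {0..<real n}"
    using n assms by (intro emeasure_mono) (auto simp: loc_finite_def sets_half_borel_iff)
  also have "\<dots> < \<infinity>"
    using assms by (simp add: loc_finite_def)
  finally show ?thesis .
qed

lemma loc_finite_sigma_finite:
  assumes "loc_finite N"
  shows "sigma_finite_measure N"
proof
  show "\<exists>A. countable A \<and> A \<subseteq> sets N \<and> \<Union>A = space N \<and> (\<forall>a\<in>A. emeasure N a \<noteq> \<infinity>)"
    using assms
    by (intro exI[of _ "range (\<lambda>n::nat. {0..<real n})"])
      (auto simp: loc_finite_def sets_half_borel_iff loc_finite_space less_top intro: reals_Archimedean2)
qed

section \<open>The positive part of a countably additive function as a measure\<close>

definition jordan_pos_value :: "(real set \<Rightarrow> real) \<Rightarrow> real set \<Rightarrow> ennreal" where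
  "jordan_pos_value r A = (SUP B \<in> {B \<in> bounded_borel. B \<subseteq> A}. ennreal (r B))"

lemma jordan_pos_value_upper:
  "B \<in> bounded_borel \<Longrightarrow> B \<subseteq> A \<Longrightarrow> ennreal (r B) \<le> jordan_pos_value r A"
  unfolding jordan_pos_value_def by (rule SUP_upper) auto

lemma jordan_pos_value_least:
  "(\<And>B. B \<in> bounded_borel \<Longrightarrow> B \<subseteq> A \<Longrightarrow> ennreal (r B) \<le> c) \<Longrightarrow> jordan_pos_value r A \<le> c"
  unfolding jordan_pos_value_def by (rule SUP_least) auto

lemma jordan_pos_value_mono: "A \<subseteq> B \<Longrightarrow> jordan_pos_value r A \<le> jordan_pos_value r B"
  by (rule jordan_pos_value_least) (auto intro: jordan_pos_value_upper)

text \<open>Competitors \<open>C\<close> for \<open>A\<close> and \<open>D\<close> for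
  \<open>B\<close> are disjoint, so their union is a competitor for \<open>A \<union> B\<close> with
  value \<open>r C + r D\<close>. Taking suprema over \<open>D\<close> and then over
  \<open>C\<close> gives the claim.\<close>

lemma jordan_pos_value_superadditive:
  assumes r: "loc_additive r" and AB: "A \<inter> B = {}"
  shows "jordan_pos_value r A + jordan_pos_value r B \<le> jordan_pos_value r (A \<union> B)"
proof -
  have pair: "ennreal (r C) + ennreal (r D) \<le> jordan_pos_value r (A \<union> B)"
    if C: "C \<in> bounded_borel" "C \<subseteq> A" and D: "D \<in> bounded_borel" "D \<subseteq> B" for C D
  \<comment> \<open>Since \<open>ennreal\<close> sends negative numbers to 0, it respects the sum
    \<open>r C + r D\<close> only for values of the right sign. If one value is not positive, the
    other set alone is a sufficient competitor.\<close>
  proof (cases "r C \<le> 0 \<or> r D \<le> 0")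
    case True
    have "ennreal (r C) \<le> jordan_pos_value r (A \<union> B)" "ennreal (r D) \<le> jordan_pos_value r (A \<union> B)"
      using C D by (auto intro!: jordan_pos_value_upper)
    with True show ?thesis
      by (auto simp: ennreal_neg)
  next
    case False
    have "C \<inter> D = {}"
      using C D AB by blast
    then have "r (C \<union> D) = r C + r D"
      using C D by (intro loc_additive_Un[OF r])
    then have "ennreal (r C) + ennreal (r D) = ennreal (r (C \<union> D))"
      using False by simp
    also have "\<dots> \<le> jordan_pos_value r (A \<union> B)"
      using C D by (intro jordan_pos_value_upper bounded_borel_Un) auto
    finally show ?thesis .
  qed
  have ne: "{B \<in> bounded_borel. B \<subseteq> A} \<noteq> {}" for A
    by (auto intro: exI[of _ "{}"])
  have "ennreal (r C) + jordan_pos_value r B \<le> jordan_pos_value r (A \<union> B)"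
    if C: "C \<in> bounded_borel" "C \<subseteq> A" for C
  proof -
    have "ennreal (r C) + jordan_pos_value r B
        = (SUP D \<in> {D \<in> bounded_borel. D \<subseteq> B}. ennreal (r C) + ennreal (r D))"
      unfolding jordan_pos_value_def using ne by (subst ennreal_SUP_add_right) auto
    also have "\<dots> \<le> jordan_pos_value r (A \<union> B)"
      using pair C by (intro SUP_least) auto
    finally show ?thesis .
  qed
  moreover have "jordan_pos_value r A + jordan_pos_value r B
      = (SUP C \<in> {C \<in> bounded_borel. C \<subseteq> A}. ennreal (r C) + jordan_pos_value r B)"
    unfolding jordan_pos_value_def[of r A] using ne by (subst ennreal_SUP_add_left) auto
  ultimately show ?thesis
    by (auto intro: SUP_least)
qed

text \<open>Finite superadditivity and monotonicity bound the series from above by the value at the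
  union. For the converse, a competitor \<open>B\<close> is cut into the pieces
  \<open>B \<inter> A i\<close>, each of which competes for \<open>A i\<close>.\<close>

lemma jordan_pos_value_countably_additive:
  assumes r: "loc_additive r"
  shows "countably_additive (sets half_borel) (jordan_pos_value r)"
proof (rule countably_additiveI)
  fix A :: "nat \<Rightarrow> real set"
  assume A: "range A \<subseteq> sets half_borel" "disjoint_family A"
  let ?p = "jordan_pos_value r"
  have "(\<Sum>i<n. ?p (A i)) \<le> ?p (\<Union>i<n. A i)" for n
  proof (induction n)
    case (Suc n)
    have "(\<Sum>i<Suc n. ?p (A i)) \<le> ?p (\<Union>i<n. A i) + ?p (A n)"
      using Suc by (simp add: add_right_mono)
    also have "\<dots> \<le> ?p ((\<Union>i<n. A i) \<union> A n)"
    proof (rule jordan_pos_value_superadditive[OF r])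
      have "A i \<inter> A n = {}" if "i < n" for i
        using A(2) that by (auto simp: disjoint_family_on_def)
      then show "(\<Union>i<n. A i) \<inter> A n = {}"
        by blast
    qed
    also have "(\<Union>i<n. A i) \<union> A n = (\<Union>i<Suc n. A i)"
      by (simp add: lessThan_Suc Un_commute)
    finally show ?case .
  qed simp
  then have "(\<Sum>i<n. ?p (A i)) \<le> ?p (\<Union>i. A i)" for n
    by (rule order_trans) (auto intro: jordan_pos_value_mono)
  then have 1: "(\<Sum>i. ?p (A i)) \<le> ?p (\<Union>i. A i)"
    by (intro suminf_le_const) (auto)
  have 2: "?p (\<Union>i. A i) \<le> (\<Sum>i. ?p (A i))"
  proof (rule jordan_pos_value_least)
    fix B assume B: "B \<in> bounded_borel" "B \<subseteq> (\<Union>i. A i)"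
    have BA: "B \<inter> A i \<in> bounded_borel" for i
      using A B by (intro bounded_borel_Int) (auto simp: sets_half_borel_iff image_subset_iff)
    have eq: "(\<Union>i. B \<inter> A i) = B"
      using B by blast
    have "disjoint_family (\<lambda>i. B \<inter> A i)"
      using A(2) by (auto simp: disjoint_family_on_def)
    then have "(\<lambda>i. r (B \<inter> A i)) sums r (\<Union>i. B \<inter> A i)"
      using BA B(1) by (intro loc_additiveD[OF r]) (auto simp only: eq)
    then have "(\<lambda>i. r (B \<inter> A i)) sums r B"
      by (simp only: eq)
    then have lim: "(\<lambda>n. ennreal (\<Sum>i<n. r (B \<inter> A i))) \<longlonglongrightarrow> ennreal (r B)"
      by (intro tendsto_ennrealI) (simp add: sums_def)
    have "ennreal (\<Sum>i<n. r (B \<inter> A i)) \<le> (\<Sum>i. ?p (A i))" for n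
    proof -
      \<comment> \<open>Replacing negative terms by 0 can only increase the sum, and makes
        \<open>ennreal\<close> commute with it.\<close>
      have "ennreal (\<Sum>i<n. r (B \<inter> A i)) \<le> ennreal (\<Sum>i<n. max 0 (r (B \<inter> A i)))"
        by (intro ennreal_leI sum_mono) auto
      also have "\<dots> = (\<Sum>i<n. ennreal (max 0 (r (B \<inter> A i))))"
        by simp
      also have "\<dots> = (\<Sum>i<n. ennreal (r (B \<inter> A i)))"
        by (intro sum.cong) (auto simp: max_def ennreal_neg)
      also have "\<dots> \<le> (\<Sum>i<n. ?p (A i))"
        using BA by (intro sum_mono jordan_pos_value_upper) auto
      also have "\<dots> \<le> (\<Sum>i. ?p (A i))"
        by (intro sum_le_suminf) auto
      finally show ?thesis .
    qed
    then show "ennreal (r B) \<le> (\<Sum>i. ?p (A i))"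
      by (intro LIMSEQ_le_const2[OF lim]) auto
  qed
  show "(\<Sum>i. ?p (A i)) = ?p (\<Union>i. A i)"
    using 1 2 by (rule antisym)
qed

lemma sets_jordan_pos: "sets (jordan_pos r) = sets half_borel"
  unfolding jordan_pos_def
  using sets.sigma_sets_eq[of half_borel] sets.space_closed[of half_borel]
  by (simp add: space_restrict_space)

text \<open>\<open>measure_of\<close> takes the prescribed values only once these are known to be
  positive and countably additive.\<close>

lemma emeasure_jordan_pos:
  assumes "loc_additive r" "A \<in> sets half_borel"
  shows "emeasure (jordan_pos r) A = jordan_pos_value r A"
proof -
  have "jordan_pos r = measure_of {0..} (sets half_borel) (jordan_pos_value r)"
    by (simp add: jordan_pos_def jordan_pos_value_def[abs_def])
  then show ?thesis
  proof (rule emeasure_measure_of)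
    show "sets half_borel \<subseteq> Pow {0..}"
      by (auto simp: sets_half_borel_iff)
    have "jordan_pos_value r {} = 0"
      using loc_additive_empty[OF assms(1)]
      by (auto intro!: antisym jordan_pos_value_least)
    then show "positive (sets (jordan_pos r)) (jordan_pos_value r)"
      by (simp add: positive_def)
    show "countably_additive (sets (jordan_pos r)) (jordan_pos_value r)"
      by (simp add: sets_jordan_pos jordan_pos_value_countably_additive assms)
    show "A \<in> sets (jordan_pos r)"
      using assms by (simp add: sets_jordan_pos)
  qed
qed

lemma loc_finite_jordan_pos:
  assumes r: "loc_additive r"
    and bd: "\<And>n::nat. \<exists>C. \<forall>B\<in>bounded_borel. B \<subseteq> {0..<real n} \<longrightarrow> r B \<le> C"
  shows "loc_finite (jordan_pos r)"
  unfolding loc_finite_def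
proof (intro conjI allI sets_jordan_pos)
  fix n :: nat
  obtain C where C: "\<And>B. B \<in> bounded_borel \<Longrightarrow> B \<subseteq> {0..<real n} \<Longrightarrow> r B \<le> C"
    using bd by blast
  have "emeasure (jordan_pos r) {0..<real n} = jordan_pos_value r {0..<real n}"
    by (rule emeasure_jordan_pos[OF r]) (auto simp: sets_half_borel_iff)
  also have "\<dots> \<le> ennreal C"
    using C by (intro jordan_pos_value_least ennreal_leI)
  also have "\<dots> < \<infinity>"
    by simp
  finally show "emeasure (jordan_pos r) {0..<real n} < \<infinity>" .
qed

text \<open>For \<open>B \<subseteq> A\<close>, \<open>r B = r A - r (A - B)\<close>, and
  \<open>- r (A - B)\<close> is at most the negative part of \<open>A\<close>. The supremum over
  \<open>B\<close> gives this half of the decomposition; the other half is the same inequality for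
  \<open>- r\<close>.\<close>

lemma jordan_decomposition_le:
  assumes r: "loc_additive r" and r': "loc_additive (\<lambda>A. - r A)"
    and fin: "loc_finite (jordan_pos r)" "loc_finite (jordan_pos (\<lambda>A. - r A))"
    and A: "A \<in> bounded_borel"
  shows "measure (jordan_pos r) A \<le> r A + measure (jordan_pos (\<lambda>A. - r A)) A"
proof -
  let ?Q = "jordan_pos (\<lambda>A. - r A)"
  have Q: "- r B \<le> measure ?Q A" if "B \<in> bounded_borel" "B \<subseteq> A" for B
  proof -
    have "ennreal (- r B) \<le> emeasure ?Q A"
      using that by (simp add: emeasure_jordan_pos[OF r'] A bounded_borel_half_borel
          jordan_pos_value_upper[of B A "\<lambda>A. - r A"])
    also have "\<dots> = ennreal (measure ?Q A)"
      using loc_finite_bounded_borel[OF fin(2) A] by (simp add: emeasure_eq_ennreal_measure)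
    finally show ?thesis
      using measure_nonneg[of ?Q A] by (auto simp: ennreal_le_iff2 simp del: measure_nonneg)
  qed
  have "emeasure (jordan_pos r) A \<le> ennreal (r A + measure ?Q A)"
    unfolding emeasure_jordan_pos[OF r bounded_borel_half_borel[OF A]]
  proof (rule jordan_pos_value_least)
    fix B assume B: "B \<in> bounded_borel" "B \<subseteq> A"
    show "ennreal (r B) \<le> ennreal (r A + measure ?Q A)"
      using Q[of "A - B"] B A loc_additive_Diff[OF r A B]
      by (intro ennreal_leI) (auto simp: bounded_borel_Diff)
  qed
  moreover have "0 \<le> r A + measure ?Q A"
    using Q[OF A] by simp
  ultimately show ?thesis
    using enn2real_leI unfolding measure_def by blast
qed

lemma jordan_decomposition:
  assumes r: "loc_additive r" and r': "loc_additive (\<lambda>A. - r A)"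
    and fin: "loc_finite (jordan_pos r)" "loc_finite (jordan_pos (\<lambda>A. - r A))"
    and A: "A \<in> bounded_borel"
  shows "r A = measure (jordan_pos r) A - measure (jordan_pos (\<lambda>A. - r A)) A"
  using jordan_decomposition_le[OF r r' fin A]
    jordan_decomposition_le[of "\<lambda>A. - r A", OF r' _ fin(2) _ A] r fin by simp

text \<open>The powers of \<open>- \<i>\<close> enumerate the parts as \<open>Re\<^sup>+, Im\<^sup>+, Re\<^sup>-, Im\<^sup>-\<close>, so that
  \<open>m = (\<Sum>k<4. \<i> ^ k * jordan_part m k)\<close> on bounded Borel sets.\<close>

definition jordan_part :: "(real set \<Rightarrow> complex) \<Rightarrow> nat \<Rightarrow> real measure" where
  "jordan_part m k = jordan_pos (\<lambda>A. Re ((- \<i>) ^ k * m A))"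

lemma jordan_part_eqs:
  "jordan_part m 0 = jordan_pos (\<lambda>A. Re (m A))"
  "jordan_part m 1 = jordan_pos (\<lambda>A. Im (m A))"
  "jordan_part m 2 = jordan_pos (\<lambda>A. - Re (m A))"
  "jordan_part m 3 = jordan_pos (\<lambda>A. - Im (m A))"
  by (simp_all add: jordan_part_def power3_eq_cube power2_eq_square)

lemma sum_upto4: "(\<Sum>k<4. f k) = f 0 + f 1 + f 2 + f (3::nat)"
  by (simp add: eval_nat_numeral)

lemma integral_loc_eq_sum:
  "integral_loc m f = (\<Sum>k<4. \<i> ^ k * (\<integral>t. f t \<partial>jordan_part m k))"
  unfolding integral_loc_def sum_upto4 jordan_part_eqs
  by (simp add: power3_eq_cube power2_eq_square algebra_simps)

lemma loc_additive_jordan_part: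
  assumes "m \<in> M_loc"
  shows "loc_additive (\<lambda>A. Re (c * m A))"
  unfolding loc_additive_def
proof (intro allI impI)
  fix A :: "nat \<Rightarrow> real set"
  assume A: "range A \<subseteq> bounded_borel" "disjoint_family A" "(\<Union>i. A i) \<in> bounded_borel"
  show "(\<lambda>i. Re (c * m (A i))) sums Re (c * m (\<Union>i. A i))"
    by (intro sums_Re sums_mult loc_additiveD M_loc_additive assms A)
qed

text \<open>Multiplication by a power of \<open>- \<i>\<close> preserves the modulus, so the bound
  on \<open>m\<close> bounds all four real set functions.\<close>

lemma loc_finite_jordan_part:
  assumes m: "m \<in> M_loc"
  shows "loc_finite (jordan_part m k)"
  unfolding jordan_part_def
proof (rule loc_finite_jordan_pos[OF loc_additive_jordan_part[OF m]])
  fix n :: nat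
  obtain C where C: "\<And>B. B \<in> bounded_borel \<Longrightarrow> B \<subseteq> {0..<real n} \<Longrightarrow> cmod (m B) \<le> C"
    using M_loc_bounded[OF m] by blast
  have "Re ((- \<i>) ^ k * m B) \<le> C" if "B \<in> bounded_borel" "B \<subseteq> {0..<real n}" for B
    using complex_Re_le_cmod[of "(- \<i>) ^ k * m B"] C[OF that]
    by (simp add: norm_mult norm_power)
  then show "\<exists>C. \<forall>B\<in>bounded_borel. B \<subseteq> {0..<real n} \<longrightarrow> Re ((- \<i>) ^ k * m B) \<le> C"
    by blast
qed

lemma M_loc_eq_sum:
  assumes m: "m \<in> M_loc" and A: "A \<in> bounded_borel"
  shows "m A = (\<Sum>k<4. \<i> ^ k * measure (jordan_part m k) A)"
proof -
  note add = loc_additive_jordan_part[OF m]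
  note fin = loc_finite_jordan_part[OF m]
  have "Re (m A) = measure (jordan_part m 0) A - measure (jordan_part m 2) A"
    using jordan_decomposition[of "\<lambda>A. Re (m A)", OF _ _ _ _ A] add[of 1] add[of "-1"] fin[of 0] fin[of 2]
    by (simp add: jordan_part_eqs)
  \<comment> \<open>The factors \<open>- \<i>\<close> and \<open>\<i>\<close> turn the real part of
    \<open>c * m A\<close> into \<open>Im (m A)\<close> and its negative.\<close>
  moreover have "Im (m A) = measure (jordan_part m 1) A - measure (jordan_part m 3) A"
    using jordan_decomposition[of "\<lambda>A. Im (m A)", OF _ _ _ _ A] add[of "-\<i>"] add[of "\<i>"] fin[of 1] fin[of 3]
    unfolding jordan_part_eqs by simp
  ultimately show ?thesis
    unfolding sum_upto4 by (simp add: complex_eq_iff power3_eq_cube power2_eq_square)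
qed


subsection \<open>Finite combinations of locally finite measures\<close>

text \<open>The majorant \<open>C\<close> on \<open>[0, n)\<close> is integrable for every locally
  finite measure, so one pair \<open>C\<close>, \<open>n\<close> supports dominated convergence for
  all the measures in a combination at once. Only arguments \<open>t \<ge> 0\<close> are
  constrained, as functions on the half line have arbitrary values elsewhere.\<close>

definition dominated :: "real \<Rightarrow> nat \<Rightarrow> (real \<Rightarrow> complex) \<Rightarrow> bool" where
  "dominated C n f \<longleftrightarrow> f \<in> borel_measurable half_borel \<and>
     (\<forall>t\<ge>0. cmod (f t) \<le> C * indicator {0..<real n} t)"

lemma dominatedI:
  assumes "f \<in> borel_measurable half_borel" "0 \<le> C"
    and "\<And>t. 0 \<le> t \<Longrightarrow> cmod (f t) \<le> C" "\<And>t. real n \<le> t \<Longrightarrow> f t = 0"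
  shows "dominated C n f"
  using assms unfolding dominated_def by (auto simp: indicator_def)

lemma dominated_measurable: "dominated C n f \<Longrightarrow> f \<in> borel_measurable half_borel"
  by (simp add: dominated_def)

lemma dominated_bound: "dominated C n f \<Longrightarrow> 0 \<le> t \<Longrightarrow> cmod (f t) \<le> C * indicator {0..<real n} t"
  by (simp add: dominated_def)

lemma dominated_zero: "dominated C n f \<Longrightarrow> 0 \<le> t \<Longrightarrow> real n \<le> t \<Longrightarrow> f t = 0"
  using dominated_bound[of C n f t] by simp

lemma loc_finite_measurable:
  "loc_finite N \<Longrightarrow> f \<in> measurable half_borel M \<Longrightarrow> f \<in> measurable N M"
  using measurable_cong_sets[OF loc_finite_sets refl] by blast

lemma loc_finite_integrable_indicator:
  "loc_finite N \<Longrightarrow> A \<in> bounded_borel \<Longrightarrow> integrable N (indicator A :: real \<Rightarrow> real)"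
  using loc_finite_bounded_borel[of N A]
  by (auto intro!: integrable_real_indicator simp: loc_finite_sets bounded_borel_half_borel)

lemma bounded_borel_Ico: "{0..<real n} \<in> bounded_borel"
  by (auto simp: bounded_borel_def)

lemma dominated_integrable:
  assumes "loc_finite N" "dominated C n f"
  shows "integrable N f"
proof (rule Bochner_Integration.integrable_bound)
  show "integrable N (\<lambda>t. C * indicator {0..<real n} t)"
    by (intro integrable_mult_right loc_finite_integrable_indicator assms bounded_borel_Ico)
  show "f \<in> borel_measurable N"
    by (rule loc_finite_measurable[OF assms(1) dominated_measurable[OF assms(2)]])
  show "AE x in N. norm (f x) \<le> norm (C * indicator {0..<real n} x)"
  proof (rule AE_I2)
    fix x assume "x \<in> space N"
    then have "norm (f x) \<le> C * indicator {0..<real n} x"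
      by (intro dominated_bound[OF assms(2)]) (simp add: loc_finite_space[OF assms(1)])
    then show "norm (f x) \<le> norm (C * indicator {0..<real n} x)"
      unfolding real_norm_def by linarith
  qed
qed

lemma dominated_convergence_loc_finite:
  assumes N: "loc_finite N" and f: "\<And>i::nat. dominated C n (f i)" "g \<in> borel_measurable half_borel"
    and lim: "\<And>t. 0 \<le> t \<Longrightarrow> (\<lambda>i. f i t) \<longlonglongrightarrow> g t"
  shows "(\<lambda>i. \<integral>t. f i t \<partial>N) \<longlonglongrightarrow> (\<integral>t. g t \<partial>N)"
proof (rule integral_dominated_convergence)
  show "integrable N (\<lambda>t. C * indicator {0..<real n} t)"
    by (intro integrable_mult_right loc_finite_integrable_indicator N bounded_borel_Ico)
  show "g \<in> borel_measurable N" "f i \<in> borel_measurable N" for i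
    using f by (auto intro!: loc_finite_measurable[OF N] dominated_measurable)
  show "AE t in N. (\<lambda>i. f i t) \<longlonglongrightarrow> g t" "AE t in N. norm (f i t) \<le> C * indicator {0..<real n} t" for i
    using lim dominated_bound[OF f(1)] by (auto simp: loc_finite_space[OF N])
qed

lemma dominated_indicator: "A \<in> bounded_borel \<Longrightarrow> \<exists>n. dominated 1 n (indicator A)"
proof -
  assume A: "A \<in> bounded_borel"
  then obtain n :: nat where "A \<subseteq> {0..<real n}"
    using bounded_borel_bound by blast
  then have "dominated 1 n (indicator A)"
    using A by (intro dominatedI borel_measurable_indicator bounded_borel_half_borel) (auto simp: indicator_def)
  then show ?thesis ..
qed

lemma integral_indicator_complex:
  assumes "loc_finite N" "A \<in> bounded_borel"
  shows "(\<integral>t. indicator A t \<partial>N) = complex_of_real (measure N A)"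
proof -
  have "(\<integral>t. indicator A t \<partial>N) = (\<integral>t. complex_of_real (indicator A t) \<partial>N)"
    by (intro Bochner_Integration.integral_cong) (auto simp: indicator_def)
  also have "\<dots> = complex_of_real (\<integral>t. indicator A t \<partial>N)"
    by (rule integral_complex_of_real)
  also have "A \<subseteq> space N"
    using assms by (auto simp: loc_finite_space bounded_borel_def)
  then have "(\<integral>t. indicator A t \<partial>N) = measure N A"
    by (simp add: Int_absorb2)
  finally show ?thesis .
qed

text \<open>A linear relation between measures on bounded Borel sets passes to simple functions by
  linearity and to \<open>f\<close> by dominated convergence. In this homogeneous form it compares
  any two representations of one set function.\<close>

lemma combination_integral_eq_0:
  fixes c :: "'i \<Rightarrow> complex"
  assumes N: "\<And>i. i \<in> I \<Longrightarrow> loc_finite (N i)"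
    and zero: "\<And>A. A \<in> bounded_borel \<Longrightarrow> (\<Sum>i\<in>I. c i * measure (N i) A) = 0"
    and f: "dominated C n f"
  shows "(\<Sum>i\<in>I. c i * (\<integral>t. f t \<partial>N i)) = 0"
proof -
  obtain F where F: "\<And>j::nat. simple_function half_borel (F j)"
    and lim: "\<And>t. t \<in> space half_borel \<Longrightarrow> (\<lambda>j. F j t) \<longlonglongrightarrow> f t"
    and bound: "\<And>j t. t \<in> space half_borel \<Longrightarrow> norm (F j t) \<le> 2 * norm (f t)"
  proof -
    obtain F where F: "\<forall>j::nat. simple_function half_borel (F j)"
        "\<forall>t\<in>space half_borel. (\<lambda>j. F j t) \<longlonglongrightarrow> f t"
        "\<forall>j. \<forall>t\<in>space half_borel. dist (F j t) 0 \<le> 2 * dist (f t) 0"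
      using borel_measurable_implies_sequence_metric[OF dominated_measurable[OF f], of 0] by blast
    then show thesis
      by (intro that[of F]) simp_all
  qed
  \<comment> \<open>The approximants satisfy \<open>norm (F j t) \<le> 2 * norm (f t)\<close>. Hence
    they vanish where \<open>f\<close> does, so \<open>n\<close> is kept and only the constant
    doubles.\<close>
  have dom: "dominated (2 * C) n (F j)" for j
    unfolding dominated_def
  proof safe
    show "F j \<in> borel_measurable half_borel"
      using F by (rule borel_measurable_simple_function)
    show "cmod (F j t) \<le> 2 * C * indicator {0..<real n} t" if "0 \<le> t" for t
      using bound[of t j] dominated_bound[OF f that] that by (simp add: space_restrict_space)
  qed
  have simple: "(\<Sum>i\<in>I. c i * (\<integral>t. F j t \<partial>N i)) = 0" for j
  proof -
    \<comment> \<open>The value 0 is removed because its level set contains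
      \<open>[n, \<infinity>)\<close> and is unbounded. The level sets of the other values lie in
      \<open>[0, n)\<close>, where the assumed relation applies.\<close>
    define Y where "Y = F j ` {0..} - {0}"
    have Y: "finite Y"
      using F[of j] by (auto simp: Y_def simple_function_def space_restrict_space)
    define S where "S y = {t \<in> {0..}. F j t = y}" for y
    have S: "S y \<in> bounded_borel" if "y \<in> Y" for y
    proof -
      have "t < real n" if "t \<in> S y" for t
        using dominated_zero[OF dom, of t j] that \<open>y \<in> Y\<close> by (cases "t < real n") (auto simp: S_def Y_def)
      then have sub: "S y \<subseteq> {0..<real n}"
        by (auto simp: S_def)
      have "F j -` {y} \<inter> space half_borel \<in> sets half_borel"
        using F by (rule simple_functionD(2))
      moreover have "S y = F j -` {y} \<inter> space half_borel"
        by (auto simp: S_def space_restrict_space)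
      ultimately have "S y \<in> sets borel"
        by (simp only: sets_half_borel_iff)
      then show ?thesis
        using sub by (rule bounded_borel_sub[OF bounded_borel_Ico])
    qed
    have F_eq: "F j t = (\<Sum>y\<in>Y. y * indicator (S y) t)" if "0 \<le> t" for t
    proof -
      have "(\<Sum>y\<in>Y. y * indicator (S y) t) = (\<Sum>y\<in>Y. if F j t = y then y else 0)"
        using that by (intro sum.cong) (auto simp: S_def)
      also have "\<dots> = F j t"
        using Y that by (auto simp: Y_def)
      finally show ?thesis ..
    qed
    have int: "(\<integral>t. F j t \<partial>N i) = (\<Sum>y\<in>Y. y * measure (N i) (S y))" if i: "i \<in> I" for i
    proof -
      have "(\<integral>t. F j t \<partial>N i) = (\<integral>t. (\<Sum>y\<in>Y. y * indicator (S y) t) \<partial>N i)"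
        using F_eq by (intro Bochner_Integration.integral_cong) (auto simp: loc_finite_space[OF N[OF i]])
      also have "\<dots> = (\<Sum>y\<in>Y. y * (\<integral>t. indicator (S y) t \<partial>N i))"
      proof (subst Bochner_Integration.integral_sum)
        show "integrable (N i) (\<lambda>t. y * indicator (S y) t)" if "y \<in> Y" for y
          using dominated_indicator[OF S[OF that]] dominated_integrable[OF N[OF i]]
          by (intro integrable_mult_right) blast
      qed simp
      also have "\<dots> = (\<Sum>y\<in>Y. y * measure (N i) (S y))"
        using N[OF i] S by (intro sum.cong) (auto simp: integral_indicator_complex)
      finally show ?thesis .
    qed
    have "(\<Sum>i\<in>I. c i * (\<integral>t. F j t \<partial>N i)) = (\<Sum>i\<in>I. \<Sum>y\<in>Y. y * (c i * measure (N i) (S y)))"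
      using int by (intro sum.cong) (auto simp: sum_distrib_left mult_ac)
    also have "\<dots> = (\<Sum>y\<in>Y. y * (\<Sum>i\<in>I. c i * measure (N i) (S y)))"
      by (subst sum.swap) (simp add: sum_distrib_left)
    also have "\<dots> = 0"
      using zero[OF S] by simp
    finally show ?thesis .
  qed
  have "(\<lambda>j. \<Sum>i\<in>I. c i * (\<integral>t. F j t \<partial>N i)) \<longlonglongrightarrow> (\<Sum>i\<in>I. c i * (\<integral>t. f t \<partial>N i))"
    using lim by (intro tendsto_sum tendsto_mult tendsto_const
        dominated_convergence_loc_finite[OF N dom dominated_measurable[OF f]])
      (auto simp: space_restrict_space)
  then show ?thesis
    unfolding simple by (simp add: LIMSEQ_const_iff)
qed

text \<open>This is a converse to \<open>M_loc_eq_sum\<close>, and the way in which new elements of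
  \<open>M_loc\<close> are produced. Over a finite disjoint family in \<open>[0, n)\<close>, the
  triangle inequality and additivity of each \<open>N i\<close> bound the variation by the sum of
  \<open>cmod (c i) * measure (N i) {0..<real n}\<close>.\<close>

lemma combination_in_M_loc:
  fixes c :: "'i \<Rightarrow> complex"
  assumes I: "finite I" and N: "\<And>i. i \<in> I \<Longrightarrow> loc_finite (N i)"
    and m: "\<And>A. A \<in> bounded_borel \<Longrightarrow> m A = (\<Sum>i\<in>I. c i * measure (N i) A)"
    and m0: "\<And>A. A \<notin> bounded_borel \<Longrightarrow> m A = 0"
  shows "m \<in> M_loc"
  unfolding M_loc_def
proof (intro CollectI conjI allI impI m0)
  fix A :: "nat \<Rightarrow> real set"
  assume A: "range A \<subseteq> bounded_borel" "disjoint_family A" "(\<Union>i. A i) \<in> bounded_borel"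
  have "(\<lambda>k. \<Sum>i\<in>I. c i * complex_of_real (measure (N i) (A k))) sums
      (\<Sum>i\<in>I. c i * complex_of_real (measure (N i) (\<Union>k. A k)))"
  proof (intro sums_sum sums_mult sums_of_real measure_UNION A)
    fix i assume i: "i \<in> I"
    show "range A \<subseteq> sets (N i)"
      using A(1) N[OF i] by (auto simp: loc_finite_sets intro!: bounded_borel_half_borel)
    show "emeasure (N i) (\<Union> (range A)) \<noteq> \<infinity>"
      using loc_finite_bounded_borel[OF N[OF i] A(3)] by simp
  qed
  then show "(\<lambda>i. m (A i)) sums m (\<Union>i. A i)"
    using A by (simp add: m range_subsetD)
next
  fix n :: nat
  let ?J = "{0..<real n}"
  let ?K = "\<Sum>i\<in>I. cmod (c i) * measure (N i) ?J"
  have "total_variation m ?J \<le> ennreal ?K"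
    unfolding total_variation_def
  proof (rule SUP_least, clarify)
    fix P assume P: "finite P" "disjoint P" "P \<subseteq> bounded_borel" "\<Union>P \<subseteq> ?J"
    have "(\<Sum>B\<in>P. cmod (m B)) \<le> (\<Sum>B\<in>P. \<Sum>i\<in>I. cmod (c i) * measure (N i) B)"
    proof (rule sum_mono)
      fix B assume "B \<in> P"
      then have "m B = (\<Sum>i\<in>I. c i * measure (N i) B)"
        using P by (auto intro: m)
      then show "cmod (m B) \<le> (\<Sum>i\<in>I. cmod (c i) * measure (N i) B)"
        by (auto intro!: sum_norm_le simp: norm_mult)
    qed
    also have "\<dots> = (\<Sum>i\<in>I. cmod (c i) * (\<Sum>B\<in>P. measure (N i) B))"
      by (subst sum.swap) (simp add: sum_distrib_left)
    also have "\<dots> \<le> ?K"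
    proof (intro sum_mono mult_left_mono norm_ge_zero)
      fix i assume i: "i \<in> I"
      have fin: "A \<in> fmeasurable (N i)" if "A \<in> bounded_borel" for A
        using that N[OF i] loc_finite_bounded_borel[OF N[OF i] that]
        by (auto simp: fmeasurable_def loc_finite_sets bounded_borel_half_borel)
      have "(\<Sum>B\<in>P. measure (N i) B) = measure (N i) (\<Union>P)"
      proof (rule measure_Union'[symmetric])
        show "pairwise disjnt P"
          using P(2) by (auto simp: disjoint_def pairwise_def disjnt_def)
      qed (use P(1,3) fin in blast)+
      also have "\<dots> \<le> measure (N i) ?J"
      proof (rule measure_mono_fmeasurable)
        have "P \<subseteq> sets (N i)"
          using P(3) fin fmeasurableD by blast
        then show "\<Union>P \<in> sets (N i)"
          using P(1) by blast
      qed (use P(4) fin[OF bounded_borel_Ico] in auto)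
      finally show "(\<Sum>B\<in>P. measure (N i) B) \<le> measure (N i) ?J" .
    qed
    finally show "(\<Sum>B\<in>P. ennreal (cmod (m B))) \<le> ennreal ?K"
      by (simp add: ennreal_leI)
  qed
  also have "\<dots> < \<infinity>"
    by simp
  finally show "total_variation m ?J < \<infinity>" .
qed

text \<open>\<open>integral_loc\<close> is defined through the Jordan parts, but any representation
  gives the same integral: the given measures together with the Jordan parts taken with opposite
  coefficients, indexed by a disjoint sum, form a combination that vanishes on bounded Borel
  sets.\<close>

lemma integral_loc_combination:
  fixes c :: "'i \<Rightarrow> complex"
  assumes I: "finite I" and N: "\<And>i. i \<in> I \<Longrightarrow> loc_finite (N i)"
    and m: "\<And>A. A \<in> bounded_borel \<Longrightarrow> m A = (\<Sum>i\<in>I. c i * measure (N i) A)" "m \<in> M_loc"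
    and f: "dominated C n f"
  shows "integral_loc m f = (\<Sum>i\<in>I. c i * (\<integral>t. f t \<partial>N i))"
proof -
  let ?N = "case_sum N (jordan_part m)"
  let ?c = "case_sum c (\<lambda>k. - (\<i> ^ k))"
  have "(\<Sum>i\<in>I <+> {..<4}. ?c i * (\<integral>t. f t \<partial>?N i)) = 0"
  proof (rule combination_integral_eq_0[OF _ _ f])
    show "loc_finite (?N i)" if "i \<in> I <+> {..<4}" for i
      using that N loc_finite_jordan_part[OF m(2)] by auto
    show "(\<Sum>i\<in>I <+> {..<4}. ?c i * measure (?N i) A) = 0" if "A \<in> bounded_borel" for A
      using m(1)[OF that] M_loc_eq_sum[OF m(2) that] I
      by (simp add: sum.Plus sum_negf)
  qed
  then show ?thesis
    using I by (simp add: sum.Plus sum_negf integral_loc_eq_sum)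
qed

lemma integral_loc_indicator:
  assumes "m \<in> M_loc" "A \<in> bounded_borel"
  shows "integral_loc m (indicator A) = m A"
  unfolding integral_loc_eq_sum M_loc_eq_sum[OF assms]
  by (simp only: integral_indicator_complex[OF loc_finite_jordan_part[OF assms(1)] assms(2)])

lemma integral_loc_dominated_convergence:
  assumes "m \<in> M_loc" "\<And>i::nat. dominated C n (f i)" "g \<in> borel_measurable half_borel"
    and "\<And>t. 0 \<le> t \<Longrightarrow> (\<lambda>i. f i t) \<longlonglongrightarrow> g t"
  shows "(\<lambda>i. integral_loc m (f i)) \<longlonglongrightarrow> integral_loc m g"
  unfolding integral_loc_eq_sum
  by (rule tendsto_sum, rule tendsto_mult, rule tendsto_const,
      rule dominated_convergence_loc_finite[OF loc_finite_jordan_part[OF assms(1)] assms(2-4)])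

subsection \<open>Multiplication by the coordinate\<close>

text \<open>The operator \<open>X\<close> on positive measures. The truncation of negative numbers
  by \<open>ennreal\<close> has no effect on the half line.\<close>

definition id_density :: "real measure \<Rightarrow> real measure" where
  "id_density N = density N (\<lambda>t. ennreal t)"

lemma integral_id_density:
  assumes N: "loc_finite N" and f: "dominated C n f"
  shows "(\<integral>t. f t \<partial>id_density N) = (\<integral>t. complex_of_real t * f t \<partial>N)"
proof -
  have "(\<lambda>t. t) \<in> borel_measurable N"
    by (rule loc_finite_measurable[OF N]) (rule measurable_restrict_space1, simp)
  moreover have "f \<in> borel_measurable N"
    by (rule loc_finite_measurable[OF N dominated_measurable[OF f]])
  moreover have "AE t in N. 0 \<le> t"
    by (auto simp: loc_finite_space[OF N])
  ultimately show ?thesis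
    unfolding id_density_def by (subst integral_density) (auto simp: scaleR_conv_of_real)
qed

text \<open>On \<open>[0, n)\<close> the density is at most \<open>n\<close>.\<close>

lemma loc_finite_id_density:
  assumes N: "loc_finite N"
  shows "loc_finite (id_density N)"
  unfolding loc_finite_def
proof (intro conjI allI)
  show "sets (id_density N) = sets half_borel"
    by (simp add: id_density_def loc_finite_sets[OF N])
  fix n :: nat
  have J: "{0..<real n} \<in> sets N"
    by (simp add: loc_finite_sets[OF N] bounded_borel_half_borel bounded_borel_Ico)
  have "(\<lambda>t. t) \<in> borel_measurable N"
    by (rule loc_finite_measurable[OF N]) (rule measurable_restrict_space1, simp)
  then have "emeasure (id_density N) {0..<real n} = (\<integral>\<^sup>+t. ennreal t * indicator {0..<real n} t \<partial>N)"
    unfolding id_density_def using J by (subst emeasure_density) auto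
  also have "\<dots> \<le> (\<integral>\<^sup>+t. ennreal (real n) * indicator {0..<real n} t \<partial>N)"
    by (intro nn_integral_mono) (auto simp: indicator_def intro: ennreal_leI)
  also have "\<dots> = ennreal (real n) * emeasure N {0..<real n}"
    using J by (rule nn_integral_cmult_indicator)
  also have "\<dots> < \<infinity>"
    using loc_finite_bounded_borel[OF N bounded_borel_Ico[of n]] by (simp add: ennreal_mult_less_top)
  finally show "emeasure (id_density N) {0..<real n} < \<infinity>" .
qed

text \<open>As \<open>t \<ge> 0\<close>, multiplication by \<open>t\<close> keeps measures positive,
  so \<open>X\<close> can act on the four parts separately.\<close>

lemma X_op_eq_sum:
  assumes \<nu>: "\<nu> \<in> M_loc" and A: "A \<in> bounded_borel"
  shows "X_op \<nu> A = (\<Sum>k<4. \<i> ^ k * measure (id_density (jordan_part \<nu> k)) A)"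
proof -
  note N = loc_finite_jordan_part[OF \<nu>]
  obtain n where n: "dominated 1 n (indicator A :: real \<Rightarrow> complex)"
    using dominated_indicator[OF A] ..
  have "X_op \<nu> A = (\<Sum>k<4. \<i> ^ k * (\<integral>t. complex_of_real t * indicator A t \<partial>jordan_part \<nu> k))"
    using A by (simp add: X_op_def integral_loc_eq_sum mult.commute)
  then show ?thesis
    by (simp add: integral_id_density[OF N n, symmetric] integral_indicator_complex[OF loc_finite_id_density[OF N] A])
qed

lemma X_op_in_M_loc:
  assumes \<nu>: "\<nu> \<in> M_loc"
  shows "X_op \<nu> \<in> M_loc"
  by (rule combination_in_M_loc[OF _ _ X_op_eq_sum[OF \<nu>]])
    (simp_all add: loc_finite_id_density loc_finite_jordan_part \<nu> X_op_def)

text \<open>\<open>X_op\<close> is defined by integrals of indicators only. Independence of the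
  representation carries the formula over to every dominated integrand.\<close>

lemma integral_loc_X_op:
  assumes \<nu>: "\<nu> \<in> M_loc" and f: "dominated C n f"
  shows "integral_loc (X_op \<nu>) f = integral_loc \<nu> (\<lambda>t. complex_of_real t * f t)"
proof -
  note N = loc_finite_jordan_part[OF \<nu>]
  have "integral_loc (X_op \<nu>) f = (\<Sum>k<4. \<i> ^ k * (\<integral>t. f t \<partial>id_density (jordan_part \<nu> k)))"
    by (rule integral_loc_combination[OF _ _ X_op_eq_sum[OF \<nu>] X_op_in_M_loc[OF \<nu>] f])
      (simp_all add: loc_finite_id_density N)
  then show ?thesis
    by (simp add: integral_id_density[OF N f] integral_loc_eq_sum[of \<nu>])
qed

subsection \<open>Test functions\<close>

lemma C_c_dominated:
  assumes "h \<in> C_c"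
  obtains C n where "dominated C n h"
proof -
  have cont: "continuous_on {0..} h" and cpt: "compact (closure {t \<in> {0..}. h t \<noteq> 0})"
    using assms by (auto simp: C_c_def)
  have "bounded {t \<in> {0..}. h t \<noteq> 0}"
    by (rule bounded_subset[OF compact_imp_bounded[OF cpt] closure_subset])
  then obtain K where K: "\<And>t. 0 \<le> t \<Longrightarrow> h t \<noteq> 0 \<Longrightarrow> \<bar>t\<bar> \<le> K"
    by (auto simp: bounded_iff)
  obtain n :: nat where n: "K < real n"
    using reals_Archimedean2 by blast
  have zero: "h t = 0" if "real n \<le> t" for t
    using K[of t] n that by (cases "h t = 0") auto
  have "compact (h ` {0..real n})"
    by (intro compact_continuous_image continuous_on_subset[OF cont]) auto
  then have "bounded (h ` {0..real n})"
    by (rule compact_imp_bounded)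
  then obtain C where C: "\<And>t. t \<in> {0..real n} \<Longrightarrow> cmod (h t) \<le> C"
    unfolding bounded_iff by blast
  have "0 \<le> C"
    by (rule order_trans[OF norm_ge_zero C[of 0]]) simp
  have "dominated C n h"
  proof (rule dominatedI)
    show "h \<in> borel_measurable half_borel"
      using cont by (rule borel_measurable_continuous_on_restrict)
    show "cmod (h t) \<le> C" if "0 \<le> t" for t
      using C[of t] zero[of t] \<open>0 \<le> C\<close> that by (cases "t \<le> real n") auto
  qed (use zero \<open>0 \<le> C\<close> in auto)
  then show thesis
    by (rule that)
qed

lemma C_cI:
  assumes "continuous_on {0..} h" "\<And>t. real n \<le> t \<Longrightarrow> h t = 0"
  shows "h \<in> C_c"
proof -
  have "{t \<in> {0..}. h t \<noteq> 0} \<subseteq> {0..real n}"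
    using assms(2) by (force simp: not_le intro: less_imp_le)
  then have "bounded {t \<in> {0..}. h t \<noteq> 0}"
    by (rule bounded_subset[OF bounded_closed_interval])
  with assms(1) show ?thesis
    by (simp add: C_c_def compact_closure)
qed

lemma C_c_times_id:
  assumes "h \<in> C_c"
  shows "(\<lambda>t. complex_of_real t * h t) \<in> C_c"
proof -
  obtain C n where h: "dominated C n h"
    using C_c_dominated[OF assms] .
  show ?thesis
  proof (rule C_cI[where n = n])
    show "continuous_on {0..} (\<lambda>t. complex_of_real t * h t)"
      using assms by (intro continuous_intros) (simp add: C_c_def)
    show "complex_of_real t * h t = 0" if "real n \<le> t" for t
      using dominated_zero[OF h _ that] that by simp
  qed
qed

text \<open>A shift by \<open>t \<ge> 0\<close> moves the support to the left, so the same
  \<open>C\<close> and \<open>n\<close> work for all \<open>t\<close>. This uniform majorant yields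
  continuity in \<open>t\<close> of the integral of \<open>h (t + s)\<close>.\<close>

lemma dominated_shift:
  assumes h: "dominated C n h" and t: "0 \<le> t"
  shows "dominated C n (\<lambda>s. h (t + s))"
  unfolding dominated_def
proof (intro conjI allI impI)
  have "(\<lambda>s. t + s) \<in> measurable half_borel half_borel"
    using t by (intro measurable_restrict_space2 measurable_restrict_space1) (auto simp: space_restrict_space)
  from measurable_compose[OF this dominated_measurable[OF h]]
  show "(\<lambda>s. h (t + s)) \<in> borel_measurable half_borel" .
  fix s :: real assume s: "0 \<le> s"
  \<comment> \<open>If \<open>s < n \<le> t + s\<close>, the value is 0 and the bound to be met is
    \<open>C\<close>. Its sign is read off from the bound on \<open>h s\<close>.\<close>
  have "0 \<le> C * indicator {0..<real n} s"
    using dominated_bound[OF h s] norm_ge_zero[of "h s"] by linarith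
  moreover have "cmod (h (t + s)) \<le> C * indicator {0..<real n} (t + s)"
    using dominated_bound[OF h] t s by simp
  ultimately show "cmod (h (t + s)) \<le> C * indicator {0..<real n} s"
    using t s by (cases "t + s < real n") (auto simp: indicator_def)
qed

text \<open>Continuity is checked along sequences, by dominated convergence with the common majorant
  of the shifts. For \<open>t \<ge> n\<close> every shifted argument lies beyond the support of
  \<open>h\<close>.\<close>

lemma C_c_integral_shift:
  assumes \<mu>: "\<mu> \<in> M_loc" and h: "h \<in> C_c"
  shows "(\<lambda>t. integral_loc \<mu> (\<lambda>s. h (t + s))) \<in> C_c"
proof -
  obtain C n where dom: "dominated C n h"
    using C_c_dominated[OF h] .
  have cont: "continuous_on {0..} h"
    using h by (simp add: C_c_def)
  show ?thesis
  proof (rule C_cI[where n = n])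
    show "continuous_on {0..} (\<lambda>t. integral_loc \<mu> (\<lambda>s. h (t + s)))"
      unfolding continuous_on_sequentially comp_def
    proof (intro allI ballI impI, elim conjE)
      fix x :: "nat \<Rightarrow> real" and a :: real
      assume a: "a \<in> {0..}" and x: "\<forall>i. x i \<in> {0..}" and lim: "x \<longlonglongrightarrow> a"
      show "(\<lambda>i. integral_loc \<mu> (\<lambda>s. h (x i + s))) \<longlonglongrightarrow> integral_loc \<mu> (\<lambda>s. h (a + s))"
      proof (rule integral_loc_dominated_convergence[OF \<mu>])
        show "dominated C n (\<lambda>s. h (x i + s))" for i
          using x by (intro dominated_shift dom) auto
        show "(\<lambda>s. h (a + s)) \<in> borel_measurable half_borel"
          using a by (intro dominated_measurable[OF dominated_shift[OF dom]]) auto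
        show "(\<lambda>i. h (x i + s)) \<longlonglongrightarrow> h (a + s)" if "0 \<le> s" for s
        proof (rule continuous_on_tendsto_compose[OF cont])
          show "(\<lambda>i. x i + s) \<longlonglongrightarrow> a + s"
            by (intro tendsto_intros lim)
        qed (use a x that in auto)
      qed
    qed
    fix t assume t: "real n \<le> t"
    have "h (t + s) = 0" if "0 \<le> s" for s
      using t that by (intro dominated_zero[OF dom]) auto
    then have "(\<integral>s. h (t + s) \<partial>jordan_part \<mu> k) = (\<integral>s. 0 \<partial>jordan_part \<mu> k)" for k
      by (intro Bochner_Integration.integral_cong) (auto simp: loc_finite_space[OF loc_finite_jordan_part[OF \<mu>]])
    then show "integral_loc \<mu> (\<lambda>s. h (t + s)) = 0"
      by (simp add: integral_loc_eq_sum)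
  qed
qed

text \<open>Continuous cutoffs converge boundedly to the indicator of \<open>[0, a]\<close>, so the
  two measures agree on these intervals. A Dynkin argument extends this to bounded Borel sets;
  elsewhere both are 0.\<close>

lemma M_loc_eqI:
  assumes \<kappa>: "\<kappa> \<in> M_loc" and \<kappa>': "\<kappa>' \<in> M_loc"
    and eq: "\<And>h. h \<in> C_c \<Longrightarrow> integral_loc \<kappa> h = integral_loc \<kappa>' h"
  shows "\<kappa> = \<kappa>'"
proof -
  have Icc: "\<kappa> {0..a} = \<kappa>' {0..a}" for a :: real
  proof (cases "0 \<le> a")
    case True
    obtain n :: nat where n: "a + 1 < real n"
      using reals_Archimedean2 by blast
    \<comment> \<open>\<open>u i\<close> is 1 up to \<open>a\<close> and then falls linearly to 0 on
      an interval of length \<open>1 / Suc i\<close>. Using \<open>Suc i\<close> instead of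
      \<open>i\<close> keeps this length at most 1, so all supports lie in
      \<open>[0, a + 1]\<close>.\<close>
    define u where "u i t = complex_of_real (max 0 (min 1 (1 - real (Suc i) * (t - a))))" for i :: nat and t
    have u0: "u i t = 0" if "a + 1 \<le> t" for i t
    proof -
      have "1 * 1 \<le> real (Suc i) * (t - a)"
        using that by (intro mult_mono) auto
      then show ?thesis
        by (simp add: u_def)
    qed
    have cont: "continuous_on S (u i)" for i S
      unfolding u_def by (intro continuous_intros)
    have C_c: "u i \<in> C_c" for i
      by (rule C_cI[where n = n]) (use u0 n cont in auto)
    have dom: "dominated 1 n (u i)" for i
    proof (rule dominatedI)
      show "u i \<in> borel_measurable half_borel"
        by (intro borel_measurable_continuous_on_restrict cont)
      show "cmod (u i t) \<le> 1" for t
        unfolding u_def norm_of_real by simp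
    qed (use u0 n in auto)
    have lim: "(\<lambda>i. u i t) \<longlonglongrightarrow> indicator {0..a} t" if "0 \<le> t" for t
    proof (cases "t \<le> a")
      case True
      then have "real (Suc i) * (t - a) \<le> 0" for i
        by (intro mult_nonneg_nonpos) auto
      then have "u i t = 1" for i
        unfolding u_def by (smt (verit) max_def min_def of_real_1)
      with True that show ?thesis
        by simp
    next
      case False
      \<comment> \<open>Beyond \<open>a\<close> the sequence is eventually 0: the ramp ends before
        \<open>t\<close> once \<open>Suc i \<ge> 1 / (t - a)\<close>.\<close>
      obtain j :: nat where j: "1 / (t - a) < real j"
        using reals_Archimedean2 by blast
      have "u i t = 0" if "j \<le> i" for i
      proof -
        have "1 / (t - a) \<le> real (Suc i)"
          using j that by linarith
        then have "1 \<le> real (Suc i) * (t - a)"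
          using False by (simp add: pos_divide_le_eq)
        then show ?thesis
          by (simp add: u_def)
      qed
      then have "\<forall>\<^sub>F i in sequentially. u i t = 0"
        using eventually_sequentially by blast
      then show ?thesis
        using False by (auto intro: tendsto_eventually)
    qed
    have meas: "(indicator {0..a} :: real \<Rightarrow> complex) \<in> borel_measurable half_borel"
      by (intro borel_measurable_indicator bounded_borel_half_borel bounded_borel_Icc)
    have "(\<lambda>i. integral_loc \<kappa> (u i)) \<longlonglongrightarrow> \<kappa> {0..a}"
      using integral_loc_dominated_convergence[OF \<kappa> dom meas lim]
      by (simp add: integral_loc_indicator[OF \<kappa> bounded_borel_Icc])
    moreover have "(\<lambda>i. integral_loc \<kappa>' (u i)) \<longlonglongrightarrow> \<kappa>' {0..a}"
      using integral_loc_dominated_convergence[OF \<kappa>' dom meas lim]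
      by (simp add: integral_loc_indicator[OF \<kappa>' bounded_borel_Icc])
    ultimately show ?thesis
      using eq[OF C_c] LIMSEQ_unique by simp
  next
    \<comment> \<open>Negative \<open>a\<close> give the empty interval; they occur below as
      \<open>min a b\<close>.\<close>
    case False
    then show ?thesis
      by (simp add: loc_additive_empty[OF M_loc_additive] \<kappa> \<kappa>')
  qed
  \<comment> \<open>Bounded Borel sets are not closed under complements, so the induction runs over
    all Borel sets of reals, each cut down to a fixed interval. The generators \<open>{..a}\<close>
    are cut to \<open>{0..min a b}\<close>.\<close>
  have cut: "\<kappa> (A \<inter> {0..b}) = \<kappa>' (A \<inter> {0..b})" if "A \<in> sets borel" for A b
  proof -
    have sig: "sigma_sets UNIV (range atMost) = sets (borel :: real measure)"
      by (simp add: borel_eq_atMost)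
    have cutb: "A \<inter> {0..b} \<in> bounded_borel" if "A \<in> sets borel" for A
      using bounded_borel_Int[OF bounded_borel_Icc that] by (simp add: Int_commute)
    have "Int_stable (range (atMost :: real \<Rightarrow> _))"
      by (auto simp: Int_stable_def)
    moreover have "range (atMost :: real \<Rightarrow> _) \<subseteq> Pow UNIV"
      by simp
    moreover have "A \<in> sigma_sets UNIV (range atMost)"
      using that sig by simp
    ultimately show ?thesis
    proof (induction A rule: sigma_sets_induct_disjoint)
      case (basic A)
      then obtain a where "A = {..a}"
        by blast
      then have "A \<inter> {0..b} = {0..min a b}"
        by auto
      then show ?case
        by (simp only: Icc)
    next
      case empty
      show ?case
        by (simp add: loc_additive_empty[OF M_loc_additive] \<kappa> \<kappa>')
    next
      case (compl A)
      then have A: "A \<in> sets borel"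
        by (simp only: sig)
      have "(UNIV - A) \<inter> {0..b} = {0..b} - A \<inter> {0..b}"
        by auto
      then show ?case
        using loc_additive_Diff[OF M_loc_additive[OF \<kappa>] bounded_borel_Icc cutb[OF A]]
          loc_additive_Diff[OF M_loc_additive[OF \<kappa>'] bounded_borel_Icc cutb[OF A]]
        by (simp add: Icc compl)
    next
      case (union F)
      have F: "F i \<in> sets borel" for i
        using union(2) sig by auto
      have "disjoint_family (\<lambda>i. F i \<inter> {0..b})"
        using union(1) by (auto simp: disjoint_family_on_def)
      moreover have "range (\<lambda>i. F i \<inter> {0..b}) \<subseteq> bounded_borel"
        using cutb[OF F] by auto
      moreover have "(\<Union>i. F i \<inter> {0..b}) \<in> bounded_borel"
        using cutb[of "\<Union>i. F i"] F by (simp add: sets.countable_UN image_subset_iff)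
      ultimately have "(\<lambda>i. m (F i \<inter> {0..b})) sums m (\<Union>i. F i \<inter> {0..b})" if "m \<in> M_loc" for m
        using that by (intro loc_additiveD M_loc_additive)
      from this[OF \<kappa>] this[OF \<kappa>'] show ?case
        unfolding union(3) UN_extend_simps(4)[symmetric] by (simp add: sums_unique2)
    qed
  qed
  show ?thesis
  proof
    fix A
    show "\<kappa> A = \<kappa>' A"
    proof (cases "A \<in> bounded_borel")
      case True
      then obtain n :: nat where "A \<subseteq> {0..<real n}"
        using bounded_borel_bound by blast
      then have "A \<inter> {0..real n} = A"
        by force
      then show ?thesis
        using cut[of A "real n"] True by (simp add: bounded_borel_sets_borel)
    next
      case False
      then show ?thesis
        using \<kappa> \<kappa>' by (simp add: M_loc_def)
    qed
  qed
qed

subsection \<open>Convolution\<close>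

definition pos_convolution :: "real measure \<Rightarrow> real measure \<Rightarrow> real measure" where
  "pos_convolution N M = distr (N \<Otimes>\<^sub>M M) half_borel (\<lambda>(t, s). t + s)"

lemma measurable_add_half_borel:
  assumes "loc_finite N" "loc_finite M"
  shows "(\<lambda>(t, s). t + s) \<in> measurable (N \<Otimes>\<^sub>M M) half_borel"
proof -
  have "(\<lambda>(t, s). t + s) \<in> measurable (half_borel \<Otimes>\<^sub>M half_borel) half_borel"
  proof (rule measurable_restrict_space2)
    have id: "(\<lambda>t. t) \<in> borel_measurable half_borel"
      by (rule measurable_restrict_space1) simp
    show "(\<lambda>(t, s). t + s) \<in> borel_measurable (half_borel \<Otimes>\<^sub>M half_borel)"
      unfolding case_prod_beta
      by (rule borel_measurable_add[OF measurable_compose[OF measurable_fst id]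
            measurable_compose[OF measurable_snd id]])
  qed (auto simp: space_pair_measure space_restrict_space)
  moreover have "sets (N \<Otimes>\<^sub>M M) = sets (half_borel \<Otimes>\<^sub>M half_borel)"
    using assms by (intro sets_pair_measure_cong loc_finite_sets)
  ultimately show ?thesis
    using measurable_cong_sets[of "N \<Otimes>\<^sub>M M" "half_borel \<Otimes>\<^sub>M half_borel" half_borel half_borel]
    by simp
qed

text \<open>If \<open>t + s < n\<close> with \<open>t\<close> and \<open>s\<close> nonnegative, both
  are below \<open>n\<close>. The preimage of \<open>[0, n)\<close> under addition therefore lies in
  a square of finite product measure.\<close>

lemma loc_finite_pos_convolution:
  assumes N: "loc_finite N" and M: "loc_finite M"
  shows "loc_finite (pos_convolution N M)"
  unfolding loc_finite_def
proof (intro conjI allI)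
  show "sets (pos_convolution N M) = sets half_borel"
    by (simp add: pos_convolution_def)
  interpret M: sigma_finite_measure M
    using M by (rule loc_finite_sigma_finite)
  fix n :: nat
  let ?J = "{0..<real n}"
  have J: "?J \<in> sets half_borel" "?J \<in> sets N" "?J \<in> sets M"
    using bounded_borel_half_borel[OF bounded_borel_Ico[of n]] by (simp_all add: loc_finite_sets N M)
  have "emeasure (pos_convolution N M) ?J
      = emeasure (N \<Otimes>\<^sub>M M) ((\<lambda>(t, s). t + s) -` ?J \<inter> space (N \<Otimes>\<^sub>M M))"
    unfolding pos_convolution_def using measurable_add_half_borel[OF N M] J(1) by (rule emeasure_distr)
  also have "\<dots> \<le> emeasure (N \<Otimes>\<^sub>M M) (?J \<times> ?J)"
    using J by (intro emeasure_mono)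
      (auto simp: space_pair_measure loc_finite_space N M)
  also have "\<dots> = emeasure N ?J * emeasure M ?J"
    using J by (intro M.emeasure_pair_measure_Times)
  also have "\<dots> < \<infinity>"
    using loc_finite_bounded_borel[OF N bounded_borel_Ico[of n]] loc_finite_bounded_borel[OF M bounded_borel_Ico[of n]]
    by (simp add: ennreal_mult_less_top)
  finally show "emeasure (pos_convolution N M) ?J < \<infinity>" .
qed

text \<open>Fubini's theorem for the product measure. The integrability of the inner integral is
  recorded because it is needed to add up the inner integrals over the parts of a complex
  measure.\<close>

lemma integral_pos_convolution:
  assumes N: "loc_finite N" and M: "loc_finite M" and f: "dominated C n f"
  shows "(\<integral>t. f t \<partial>pos_convolution N M) = (\<integral>t. \<integral>s. f (t + s) \<partial>M \<partial>N)"
    and "integrable N (\<lambda>t. \<integral>s. f (t + s) \<partial>M)"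
proof -
  interpret N: sigma_finite_measure N
    using N by (rule loc_finite_sigma_finite)
  interpret M: sigma_finite_measure M
    using M by (rule loc_finite_sigma_finite)
  interpret pair_sigma_finite N M ..
  have int: "integrable (N \<Otimes>\<^sub>M M) (\<lambda>x. f (case x of (t, s) \<Rightarrow> t + s))"
    using dominated_integrable[OF loc_finite_pos_convolution[OF N M] f]
    unfolding pos_convolution_def
    by (subst (asm) integrable_distr_eq[OF measurable_add_half_borel[OF N M] dominated_measurable[OF f]])
  have "(\<integral>t. f t \<partial>pos_convolution N M) = (\<integral>x. f (case x of (t, s) \<Rightarrow> t + s) \<partial>(N \<Otimes>\<^sub>M M))"
    unfolding pos_convolution_def
    by (rule integral_distr[OF measurable_add_half_borel[OF N M] dominated_measurable[OF f]])
  with integral_fst'[OF int] show "(\<integral>t. f t \<partial>pos_convolution N M) = (\<integral>t. \<integral>s. f (t + s) \<partial>M \<partial>N)"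
    by simp
  from integrable_fst'[OF int] show "integrable N (\<lambda>t. \<integral>s. f (t + s) \<partial>M)"
    by simp
qed

text \<open>Convolution is bilinear, so \<kappa> is assembled from the sixteen convolutions of a
  part of \<nu> with a part of \<mu>, and Fubini is applied to each.\<close>

lemma convolution_exists:
  assumes \<nu>: "\<nu> \<in> M_loc" and \<mu>: "\<mu> \<in> M_loc"
  shows "\<exists>\<kappa>\<in>M_loc. \<forall>h\<in>C_c. integral_loc \<kappa> h = integral_loc \<nu> (\<lambda>t. integral_loc \<mu> (\<lambda>s. h (t + s)))"
proof -
  note N = loc_finite_jordan_part[OF \<nu>] and M = loc_finite_jordan_part[OF \<mu>]
  let ?I = "{..<4::nat} \<times> {..<4::nat}"
  define c :: "nat \<times> nat \<Rightarrow> complex" where "c = (\<lambda>(j, k). \<i> ^ j * \<i> ^ k)"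
  define P where "P = (\<lambda>(j, k). pos_convolution (jordan_part \<nu> j) (jordan_part \<mu> k))"
  define \<kappa> where "\<kappa> A = (if A \<in> bounded_borel then \<Sum>i\<in>?I. c i * measure (P i) A else 0)" for A
  have P: "loc_finite (P i)" for i
    by (simp add: P_def split_beta loc_finite_pos_convolution N M)
  have \<kappa>_eq: "\<kappa> A = (\<Sum>i\<in>?I. c i * measure (P i) A)" if "A \<in> bounded_borel" for A
    using that by (simp add: \<kappa>_def)
  have \<kappa>: "\<kappa> \<in> M_loc"
    by (rule combination_in_M_loc[OF _ P \<kappa>_eq]) (simp_all add: \<kappa>_def)
  have "integral_loc \<kappa> h = integral_loc \<nu> (\<lambda>t. integral_loc \<mu> (\<lambda>s. h (t + s)))" if h_C_c: "h \<in> C_c" for h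
  proof -
    obtain C n where h: "dominated C n h"
      using C_c_dominated[OF h_C_c] .
    note conv = integral_pos_convolution[OF N M h]
    have "integral_loc \<kappa> h = (\<Sum>i\<in>?I. c i * (\<integral>t. h t \<partial>P i))"
      by (rule integral_loc_combination[OF _ P \<kappa>_eq \<kappa> h]) simp
    also have "\<dots> = (\<Sum>j<4. \<Sum>k<4. c (j, k) * (\<integral>t. h t \<partial>P (j, k)))"
      by (simp add: sum.cartesian_product split_beta)
    also have "\<dots> = (\<Sum>j<4. \<i> ^ j * (\<Sum>k<4. \<i> ^ k * (\<integral>t. \<integral>s. h (t + s) \<partial>jordan_part \<mu> k \<partial>jordan_part \<nu> j)))"
      by (simp add: c_def P_def conv(1) sum_distrib_left mult.assoc)
    \<comment> \<open>The sum over the parts of \<mu> moves inside the integral over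
      \<open>t\<close> by the integrability in \<open>conv(2)\<close>.\<close>
    also have "\<dots> = (\<Sum>j<4. \<i> ^ j * (\<integral>t. (\<Sum>k<4. \<i> ^ k * (\<integral>s. h (t + s) \<partial>jordan_part \<mu> k)) \<partial>jordan_part \<nu> j))"
      using conv(2) by simp
    also have "\<dots> = integral_loc \<nu> (\<lambda>t. integral_loc \<mu> (\<lambda>s. h (t + s)))"
      by (simp only: integral_loc_eq_sum)
    finally show ?thesis .
  qed
  with \<kappa> show ?thesis
    by blast
qed

text \<open>Existence and uniqueness turn the definite description in \<open>convolution\<close>
  into usable facts.\<close>

lemma convolution_props:
  assumes "\<nu> \<in> M_loc" "\<mu> \<in> M_loc"
  shows "convolution \<nu> \<mu> \<in> M_loc"
    and "h \<in> C_c \<Longrightarrow> integral_loc (convolution \<nu> \<mu>) h = integral_loc \<nu> (\<lambda>t. integral_loc \<mu> (\<lambda>s. h (t + s)))"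
proof -
  let ?P = "\<lambda>\<kappa>. \<kappa> \<in> M_loc \<and>
     (\<forall>h\<in>C_c. integral_loc \<kappa> h = integral_loc \<nu> (\<lambda>t. integral_loc \<mu> (\<lambda>s. h (t + s))))"
  have "\<exists>!\<kappa>. ?P \<kappa>"
  proof (rule ex_ex1I)
    show "\<exists>\<kappa>. ?P \<kappa>"
      using convolution_exists[OF assms] by blast
    show "\<kappa> = \<kappa>'" if "?P \<kappa>" "?P \<kappa>'" for \<kappa> \<kappa>'
      using that by (intro M_loc_eqI) simp_all
  qed
  then have "?P (convolution \<nu> \<mu>)"
    unfolding convolution_def by (rule theI')
  then show "convolution \<nu> \<mu> \<in> M_loc"
    and "h \<in> C_c \<Longrightarrow> integral_loc (convolution \<nu> \<mu>) h = integral_loc \<nu> (\<lambda>t. integral_loc \<mu> (\<lambda>s. h (t + s)))"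
    by blast+
qed

section \<open>The transpose of the derivation on test functions\<close>

lemma D_bar_in_M_loc: "\<nu> \<in> M_loc \<Longrightarrow> \<mu> \<in> M_loc \<Longrightarrow> D_bar \<mu> \<nu> \<in> M_loc"
  by (simp add: D_bar_def convolution_props X_op_in_M_loc)

text \<open>The derivation is the transpose of a map from test functions to test functions:
  correlation with \<mu> followed by multiplication by \<open>t\<close>. \<open>X\<close> is moved
  from \<nu> to the integrand, which is dominated because the correlation is again a test
  function.\<close>

lemma pairing_D_bar:
  assumes \<nu>: "\<nu> \<in> M_loc" and \<mu>: "\<mu> \<in> M_loc" and h: "h \<in> C_c"
  shows "pairing h (D_bar \<mu> \<nu>) = pairing (\<lambda>t. complex_of_real t * integral_loc \<mu> (\<lambda>s. h (t + s))) \<nu>"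
proof -
  obtain C n where "dominated C n (\<lambda>t. integral_loc \<mu> (\<lambda>s. h (t + s)))"
    using C_c_dominated[OF C_c_integral_shift[OF \<mu> h]] .
  then show ?thesis
    by (simp add: pairing_def D_bar_def convolution_props X_op_in_M_loc integral_loc_X_op \<nu> \<mu> h)
qed

theorem proposition3p1:
  fixes \<mu> :: "real set \<Rightarrow> complex"
  assumes "\<mu> \<in> M_loc"
  shows "continuous_map weak_star weak_star (D_bar \<mu>)"
proof -
  let ?S = "{{m \<in> M_loc. pairing h m \<in> U} | h U. h \<in> C_c \<and> open U}"
  have "continuous_map weak_star (topology_generated_by ?S) (D_bar \<mu>)"
  proof (rule continuous_on_generated_topo)
    \<comment> \<open>Besides open preimages of generating sets, continuity into a generated
      topology requires the image to lie in the union of the generators.\<close>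
    have "\<Union>?S = M_loc"
      using topspace_weak_star unfolding weak_star_def topology_generated_by_topspace .
    moreover have "D_bar \<mu> ` topspace weak_star \<subseteq> M_loc"
      using D_bar_in_M_loc[OF _ assms] by (auto simp: topspace_weak_star)
    ultimately show "D_bar \<mu> ` topspace weak_star \<subseteq> \<Union>?S"
      by simp
    fix V assume "V \<in> ?S"
    then obtain h U where V: "V = {m \<in> M_loc. pairing h m \<in> U}" and h: "h \<in> C_c" and U: "open U"
      by blast
    let ?g = "\<lambda>t. complex_of_real t * integral_loc \<mu> (\<lambda>s. h (t + s))"
    \<comment> \<open>The preimage of the generating set given by \<open>h\<close> and
      \<open>U\<close> is again a generating set, given by \<open>?g\<close> and the same
      \<open>U\<close>.\<close>
    have "D_bar \<mu> -` V \<inter> topspace weak_star = {\<nu> \<in> M_loc. pairing ?g \<nu> \<in> U}"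
      using assms h by (auto simp: V topspace_weak_star D_bar_in_M_loc pairing_D_bar)
    moreover have "?g \<in> C_c"
      using assms h by (intro C_c_times_id C_c_integral_shift)
    ultimately show "openin weak_star (D_bar \<mu> -` V \<inter> topspace weak_star)"
      unfolding weak_star_def using U by (auto intro!: topology_generated_by_Basis)
  qed
  then show ?thesis
    by (simp only: weak_star_def)
qed

end
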